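(* Let $P\subset\mathbb{R}^3$ be a convex lattice polytope of lattice width one enclosed between the planes $x=0$ and $x=1$. Denote $P_0=P\cap\{x=0\}$ and $P_1=P\cap\{x=1\}$, and consider $P_0$ and $P_1$ as subsets of the $(y,z)$-plane $\mathbb{R}^2$ by ignoring the $x$-coordinate. Suppose that, up to a lattice translation, $P_1$ is contained in the convex hull of the interior lattice points of $P_0$. Then $\operatorname{ls}_\Delta(P)=\operatorname{ls}_{\Delta_2}(P_0)$, and there exists a basis of $\mathbb{Z}^3$ that is reduced with respect to $P$ and computes $\operatorname{ls}_\Delta(P)$.
   Context: A lattice polytope in $\mathbb{R}^d$ is a convex polytope all of whose vertices lie in $\mathbb{Z}^d$. $\mathrm{AGL}(d,\mathbb{Z})$ is the group of affine unimodular maps $T(x)=Ax+h$ with $A\in\mathrm{GL}(d,\mathbb{Z})$ and $h\in\mathbb{Z}^d$. For a matrix $A$, $AP=\{Ax: x\in P\}$. Lattice size: for a lattice polytope $P\subset\mathbb{R}^d$ and the standard simplex $\operatorname{conv}\{0,e_1,\dots,e_d\}\subset\mathbb{R}^d$, the lattice size is the smallest $l\ge 0$ such that $T(P)$ is contained in the $l$-dilate of the standard simplex for some $T\in\mathrm{AGL}(d,\mathbb{Z})$. It is denoted $\operatorname{ls}_\Delta(P)$ for $d=3$ ($\Delta\subset\mathbb{R}^3$ the standard simplex) and $\operatorname{ls}_{\Delta_2}$ for $d=2$ ($\Delta_2\subset\mathbb{R}^2$ the standard $2$-simplex). Naive lattice size: $\operatorname{nls}_\Delta(P)$ is the smallest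 $l$ such that $T(P)\subset l\Delta$ for some $T$ that is a composition of multiplication by a diagonal matrix with entries $\pm1$ on the diagonal and a lattice translation. A basis $(h_1,h_2,h_3)$ of $\mathbb{Z}^3$ computes $\operatorname{ls}_\Delta(P)$ if $\operatorname{ls}_\Delta(P)=\operatorname{nls}_\Delta(AP)$, where $A$ is the matrix with rows $h_1,h_2,h_3$. For $h\in\mathbb{R}^d$, $\operatorname{w}_h(P)=\max_{x\in P}\langle h,x\rangle-\min_{x\in P}\langle h,x\rangle$, and the lattice width of $P$ is the minimum of $\operatorname{w}_h(P)$ over nonzero primitive $h\in\mathbb{Z}^d$. Write $\Vert h\Vert=\operatorname{w}_h(P)$. A basis $(h_1,h_2,h_3)$ of $\mathbb{Z}^3$ is reduced with respect to $P\subset\mathbb{R}^3$ if (1) $\Vert h_1\Vert\le\Vert h_2\Vert\le\Vert h_3\Vert$; (2) $\Vert h_1\pm h_2\Vert\ge\Vert h_2\Vert$ (both signs); (3) $\Vert mh_1+nh_2+h_3\Vert\ge\Vert h_3\Vert$ for all $m,n\in\mathbb{Z}$. *)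

theory Defs
  imports "HOL-Analysis.Analysis"
begin

definition of_int_vec :: "int ^ 'n \<Rightarrow> real ^ 'n" where
  "of_int_vec v = (\<chi> i. real_of_int (v $ i))"

definition int_lattice :: "(real ^ 'n) set" where
  "int_lattice = range of_int_vec"

text \<open>The library's \<open>polytope\<close> admits the empty set, for which width and lattice size
  make no sense; it is excluded here.\<close>

definition lattice_polytope :: "(real ^ 'n) set \<Rightarrow> bool" where
  "lattice_polytope P \<longleftrightarrow>
     polytope P \<and> P \<noteq> {} \<and> {v. v extreme_point_of P} \<subseteq> int_lattice"

definition int_mat_image :: "int ^ 'n ^ 'n \<Rightarrow> (real ^ 'n) set \<Rightarrow> (real ^ 'n) set" where
  "int_mat_image A P = (\<lambda>x. map_matrix real_of_int A *v x) ` P"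

text \<open>Over the ring of integers, \<open>invertible\<close> asks for an inverse with integer entries,
  so it is membership in \<open>GL(n, \<int>)\<close>.\<close>

definition AGL_int :: "(real ^ 'n \<Rightarrow> real ^ 'n) set" where
  "AGL_int = {T. \<exists>(A :: int ^ 'n ^ 'n) (h :: int ^ 'n). invertible A \<and>
     T = (\<lambda>x. map_matrix real_of_int A *v x + of_int_vec h)}"

definition signed_translations :: "(real ^ 'n \<Rightarrow> real ^ 'n) set" where
  "signed_translations = {T. \<exists>(D :: int ^ 'n ^ 'n) (h :: int ^ 'n).
     (\<forall>i j. i \<noteq> j \<longrightarrow> D $ i $ j = 0) \<and> (\<forall>i. D $ i $ i = 1 \<or> D $ i $ i = - 1) \<and>
     T = (\<lambda>x. map_matrix real_of_int D *v x + of_int_vec h)}"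

definition standard_simplex :: "(real ^ 'n) set" where
  "standard_simplex = convex hull (insert 0 (range (\<lambda>i. axis i 1)))"

text \<open>For a lattice polytope both minima below exist: the images \<open>T ` P\<close> are again lattice
  polytopes, so the least admissible \<open>l\<close> for each \<open>T\<close> is an integer. In the second one the
  condition \<open>0 \<le> l\<close> is needed because negative dilates are reflected simplices.\<close>

definition lattice_size :: "(real ^ 'n) set \<Rightarrow> real" where
  "lattice_size P =
     (LEAST l. 0 \<le> l \<and> (\<exists>T \<in> AGL_int. T ` P \<subseteq> (\<lambda>x. l *\<^sub>R x) ` standard_simplex))"

definition naive_lattice_size :: "(real ^ 'n) set \<Rightarrow> real" where
  "naive_lattice_size P =
     (LEAST l. 0 \<le> l \<and> (\<exists>T \<in> signed_translations. T ` P \<subseteq> (\<lambda>x. l *\<^sub>R x) ` standard_simplex))"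

text \<open>On a nonempty compact \<open>P\<close> the supremum and infimum are attained.\<close>

definition width :: "real ^ 'n \<Rightarrow> (real ^ 'n) set \<Rightarrow> real" where
  "width h P = (SUP x\<in>P. h \<bullet> x) - (INF x\<in>P. h \<bullet> x)"

definition primitive_vec :: "int ^ 'n \<Rightarrow> bool" where
  "primitive_vec h \<longleftrightarrow> h \<noteq> 0 \<and> Gcd (range (\<lambda>i. h $ i)) = 1"

text \<open>For a lattice polytope the widths are natural numbers, so the infimum is a minimum.\<close>

definition lattice_width :: "(real ^ 'n) set \<Rightarrow> real" where
  "lattice_width P = (INF h\<in>{h. primitive_vec h}. width (of_int_vec h) P)"

definition int_basis :: "int ^ 3 \<Rightarrow> int ^ 3 \<Rightarrow> int ^ 3 \<Rightarrow> bool" where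
  "int_basis h1 h2 h3 \<longleftrightarrow>
     (\<forall>v. \<exists>!(a, b, c). v = a *s h1 + b *s h2 + c *s h3)"

definition reduced_basis :: "(real ^ 3) set \<Rightarrow> int ^ 3 \<Rightarrow> int ^ 3 \<Rightarrow> int ^ 3 \<Rightarrow> bool" where
  "reduced_basis P h1 h2 h3 \<longleftrightarrow> int_basis h1 h2 h3 \<and>
     (let N = (\<lambda>h. width (of_int_vec h) P) in
        N h1 \<le> N h2 \<and> N h2 \<le> N h3 \<and>
        N (h1 + h2) \<ge> N h2 \<and> N (h1 - h2) \<ge> N h2 \<and>
        (\<forall>m n. N (m *s h1 + n *s h2 + h3) \<ge> N h3))"

definition computes_lattice_size :: "(real ^ 3) set \<Rightarrow> int ^ 3 \<Rightarrow> int ^ 3 \<Rightarrow> int ^ 3 \<Rightarrow> bool" where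
  "computes_lattice_size P h1 h2 h3 \<longleftrightarrow> int_basis h1 h2 h3 \<and>
     lattice_size P = naive_lattice_size (int_mat_image (vector [h1, h2, h3]) P)"

definition x_slice :: "real \<Rightarrow> (real ^ 3) set \<Rightarrow> (real ^ 2) set" where
  "x_slice t P = (\<lambda>p. vector [p $ 2, p $ 3]) ` (P \<inter> {p. p $ 1 = t})"

end

theory Submission
  imports Defs
begin

text \<open>Let \<open>M\<close> be the support function of \<open>P\<^sub>0\<close>. Placing a polygon in an \<open>l\<close>-dilate of the standard
  simplex after the map with rows \<open>- a\<close>, \<open>- b\<close> costs exactly \<open>l = M a + M b + M c\<close>, where
  \<open>a + b + c = 0\<close>, so the lattice size of \<open>P\<^sub>0\<close> is the least cost of a unimodular triple. A triple
  with determinant \<open>D\<close>, \<open>\<bar>D\<bar> > 1\<close>, can be replaced by one of smaller nonzero determinant and no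
  larger cost, hence the least cost over all nondegenerate triples is already attained by a
  unimodular one, and an exchange argument shows that it is reduced.

  In dimension three the cost is a sum over four functionals summing to zero; restricting them to
  \<open>P\<^sub>0\<close> and merging two of them gives a nondegenerate triple in the plane, so \<open>P\<close> is at least as
  expensive as \<open>P\<^sub>0\<close>. Conversely, as \<open>P\<^sub>1\<close> sits inside the hull of interior lattice points of \<open>P\<^sub>0\<close>,
  nonzero integral functionals lose at least \<open>1\<close> on it. Adding \<open>x\<close> to their lifts therefore does
  not change their maximum, and the lifted triple together with \<open>x\<close> has the same cost and is reduced.\<close>

section \<open>Triples of planar functionals\<close>

definition det2 :: "int ^ 2 \<Rightarrow> int ^ 2 \<Rightarrow> int" where
  "det2 a b = a $ 1 * b $ 2 - a $ 2 * b $ 1"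

lemma det2_swap: "det2 b a = - det2 a b"
  by (simp add: det2_def)

text \<open>What the planar argument needs of the support function of a lattice polygon, restricted
  to integer functionals. Integrality makes costs integers, so that a cheapest triple
  exists.\<close>

locale integral_sublinear =
  fixes M :: "int ^ 2 \<Rightarrow> real"
  assumes subadd: "M (a + b) \<le> M a + M b"
    and scale: "0 \<le> n \<Longrightarrow> M (n *s a) = of_int n * M a"
    and integral: "M a \<in> \<int>"
begin

definition wd :: "int ^ 2 \<Rightarrow> real" where
  "wd a = M a + M (- a)"

lemma zero: "M 0 = 0"
  using scale[of 0 0] by simp

lemma wd_minus [simp]: "wd (- a) = wd a"
  by (simp add: wd_def)

lemma wd_subadd: "wd (a + b) \<le> wd a + wd b"
  using subadd[of a b] subadd[of "- a" "- b"] by (simp add: wd_def)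

lemma wd_scale: "0 \<le> n \<Longrightarrow> wd (n *s a) = of_int n * wd a"
  using scale[of n a] scale[of n "- a"] by (simp add: wd_def vector_smult_rneg distrib_left)

lemma wd_minus_commute: "wd (a - b) = wd (b - a)"
  using wd_minus[of "a - b"] by simp

section \<open>Triples of sum zero: costs and determinant descent\<close>

lemma triple_nonneg: "a + b + c = 0 \<Longrightarrow> 0 \<le> M a + M b + M c"
  using subadd[of "a + b" c] subadd[of a b] by (simp add: zero)

text \<open>Convexity without division: \<open>p\<close> is the combination with rational weights
  \<open>x / D\<close> and \<open>y / D\<close>, but \<open>M\<close> takes integer vectors
  only.\<close>

lemma combination:
  assumes "D *s p = x *s a + y *s b" "0 \<le> x" "0 \<le> y" "0 < D"
  shows "of_int D * M p \<le> of_int x * M a + of_int y * M b"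
  using subadd[of "x *s a" "y *s b"] scale[of x a] scale[of y b] scale[of D p] assms by simp

text \<open>The fractional lattice point \<open>p\<close> replaces \<open>a\<close> if \<open>T = 0\<close>; otherwise \<open>- p\<close> and \<open>p - a\<close> are, modulo
  \<open>a + b + c = 0\<close>, nonnegative combinations of \<open>b\<close> and \<open>c\<close> with total weight \<open>1\<close> on each.\<close>

lemma descent_step:
  assumes sum: "a + b + c = 0" and nz: "det2 a b \<noteq> 0"
    and p: "D *s p = S *s a + T *s b" and T: "0 \<le> T" "T \<le> S" and S: "0 < S" "S < D"
  obtains a' b' c' where "a' + b' + c' = 0" "det2 a' b' \<noteq> 0" "\<bar>det2 a' b'\<bar> < \<bar>det2 a b\<bar>"
    "M a' + M b' + M c' \<le> M a + M b + M c"
proof -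
  have D: "0 < D" using S by simp
  have c: "c = - a - b" using sum by (simp add: algebra_simps eq_neg_iff_add_eq_0)
  have p1: "D * p $ 1 = S * a $ 1 + T * b $ 1" and p2: "D * p $ 2 = S * a $ 2 + T * b $ 2"
    using p by (simp_all add: vec_eq_iff)
  \<comment> \<open>Each replacement scales the determinant by some \<open>k / D\<close> of absolute
    value strictly between 0 and 1, so it shrinks without vanishing.\<close>
  have smaller: "x \<noteq> 0 \<and> \<bar>x\<bar> < \<bar>det2 a b\<bar>" if "D * x = k * det2 a b" "0 < \<bar>k\<bar>" "\<bar>k\<bar> < D" for x k
  proof
    show "x \<noteq> 0" using that nz by auto
    have "D * \<bar>x\<bar> = \<bar>k\<bar> * \<bar>det2 a b\<bar>"
      using that(1) D by (metis abs_mult abs_of_pos)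
    also have "\<dots> < D * \<bar>det2 a b\<bar>" using that nz by simp
    finally show "\<bar>x\<bar> < \<bar>det2 a b\<bar>" using D by simp
  qed
  show thesis
  proof (cases "T = 0")
    case True
    have det: "D * det2 p b = S * det2 a b"
      using p1 p2 True by (simp add: det2_def right_diff_distrib flip: mult.assoc)
    have "of_int D * M p \<le> of_int S * M a + of_int 0 * M b"
      by (rule combination) (use p T S D True in auto)
    moreover have "of_int D * M (- p - b) \<le> of_int D * M c + of_int (D - S) * M a"
    proof (rule combination)
      show "D *s (- p - b) = D *s c + (D - S) *s a"
        using p1 p2 True by (simp add: vec_eq_iff forall_2 c algebra_simps)
    qed (use S D in auto)
    ultimately have "of_int D * (M p + M b + M (- p - b)) \<le> of_int D * (M a + M b + M c)"
      by (simp add: algebra_simps)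
    then have "M p + M b + M (- p - b) \<le> M a + M b + M c" using D by simp
    with smaller[OF det] S show thesis by (intro that[of p b "- p - b"]) auto
  next
    case False
    have det: "D * det2 a (- p) = (- T) * det2 a b"
    proof -
      have "D * det2 a (- p) = a $ 2 * (D * p $ 1) - a $ 1 * (D * p $ 2)"
        by (simp add: det2_def algebra_simps)
      also have "\<dots> = (- T) * det2 a b"
        unfolding p1 p2 by (simp add: det2_def algebra_simps)
      finally show ?thesis .
    qed
    have "of_int D * M (- p) \<le> of_int (S - T) * M b + of_int S * M c"
    proof (rule combination)
      show "D *s (- p) = (S - T) *s b + S *s c"
        using p1 p2 by (simp add: vec_eq_iff forall_2 c algebra_simps)
    qed (use T S D in auto)
    moreover have "of_int D * M (p - a) \<le> of_int (D + T - S) * M b + of_int (D - S) * M c"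
    proof (rule combination)
      show "D *s (p - a) = (D + T - S) *s b + (D - S) *s c"
        using p1 p2 by (simp add: vec_eq_iff forall_2 c algebra_simps)
    qed (use T S D in auto)
    ultimately have "of_int D * (M a + M (- p) + M (p - a)) \<le> of_int D * (M a + M b + M c)"
      by (simp add: algebra_simps)
    then have "M a + M (- p) + M (p - a) \<le> M a + M b + M c" using D by simp
    with smaller[OF det] T S False show thesis by (intro that[of a "- p" "p - a"]) auto
  qed
qed

text \<open>The vectors \<open>a\<close> and \<open>b\<close> span a sublattice of index greater
  than 1, so some standard basis vector lies outside it. Reducing its rational coordinates modulo 1
  moves it into the half-open parallelogram, away from the origin.\<close>

lemma fractional_point:
  assumes "1 < \<bar>det2 a b\<bar>"
  obtains D p S T where "D *s p = S *s a + T *s b" "0 \<le> S" "S < D" "0 \<le> T" "T < D"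
    "S \<noteq> 0 \<or> T \<noteq> 0"
proof -
  define d where "d = det2 a b"
  define D where "D = \<bar>d\<bar>"
  have D: "1 < D" using assms by (simp add: D_def d_def)
  note goal = that
  have *: thesis if q: "d *s q = s *s a + t *s b" and nd: "\<not> (d dvd s \<and> d dvd t)" for q s t
  proof -
    \<comment> \<open>The sign of \<open>d\<close> moves into the numerators, so that the
      denominator \<open>D\<close> is positive.\<close>
    define s' t' where "s' = sgn d * s" and "t' = sgn d * t"
    have q': "D *s q = s' *s a + t' *s b"
    proof -
      have "sgn d *s (d *s q) = sgn d *s (s *s a + t *s b)" using q by simp
      then show ?thesis
        by (simp add: D_def s'_def t'_def vec_eq_iff abs_sgn algebra_simps)
    qed
    have nd': "\<not> (D dvd s' \<and> D dvd t')"
      using nd D by (auto simp: D_def s'_def t'_def sgn_if split: if_splits)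
    show thesis
    proof (rule goal)
      show "D *s (q - (s' div D) *s a - (t' div D) *s b) = (s' mod D) *s a + (t' mod D) *s b"
        using q' by (simp add: vec_eq_iff minus_div_mult_eq_mod[symmetric] algebra_simps)
      show "s' mod D \<noteq> 0 \<or> t' mod D \<noteq> 0" using nd' by (auto simp: dvd_eq_mod_eq_0)
    qed (use D in auto)
  qed
  show thesis
  proof (cases "d dvd a $ 1 \<and> d dvd a $ 2 \<and> d dvd b $ 1 \<and> d dvd b $ 2")
    case True
    \<comment> \<open>If \<open>d\<close> divided all four entries, its square would divide the
      determinant \<open>d\<close> itself.\<close>
    then obtain k l m n where "a $ 1 = d * k" "a $ 2 = d * l" "b $ 1 = d * m" "b $ 2 = d * n"
      by (auto elim!: dvdE)
    then have "d = d * (d * (k * n - l * m))"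
      by (subst d_def) (simp add: det2_def algebra_simps)
    moreover have "d \<noteq> 0" using D by (auto simp: D_def)
    ultimately have "1 = d * (k * n - l * m)" by simp
    then have "d dvd 1" by (rule dvdI)
    then have False using D by (simp add: D_def)
    then show thesis ..
  next
    case False
    \<comment> \<open>Cramer's rule for the standard basis vectors; by the case assumption some
      coordinate is not an integer.\<close>
    have "d *s vector [1, 0] = (b $ 2) *s a + (- (a $ 2)) *s b"
      "d *s vector [0, 1] = (- (b $ 1)) *s a + (a $ 1) *s b"
      by (simp_all add: vec_eq_iff forall_2 d_def det2_def algebra_simps)
    with False *[of _ "b $ 2" "- (a $ 2)"] *[of _ "- (b $ 1)" "a $ 1"] show thesis by auto
  qed
qed

text \<open>Induction on the absolute determinant: while it exceeds 1,
  \<open>fractional_point\<close> supplies the point with which \<open>descent_step\<close> lowers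
  it at no extra cost.\<close>

lemma unimodular_triple_below:
  assumes "a + b + c = 0" "det2 a b \<noteq> 0"
  shows "\<exists>a' b' c'. a' + b' + c' = 0 \<and> \<bar>det2 a' b'\<bar> = 1 \<and> M a' + M b' + M c' \<le> M a + M b + M c"
  using assms
proof (induction "nat \<bar>det2 a b\<bar>" arbitrary: a b c rule: less_induct)
  case less
  show ?case
  proof (cases "\<bar>det2 a b\<bar> = 1")
    case True
    then show ?thesis using less.prems by blast
  next
    case False
    with less.prems have "1 < \<bar>det2 a b\<bar>" by auto
    then obtain D p S T where p: "D *s p = S *s a + T *s b" "0 \<le> S" "S < D" "0 \<le> T" "T < D"
      "S \<noteq> 0 \<or> T \<noteq> 0" by (rule fractional_point)
    obtain a' b' c' where *: "a' + b' + c' = 0" "det2 a' b' \<noteq> 0" "\<bar>det2 a' b'\<bar> < \<bar>det2 a b\<bar>"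
      "M a' + M b' + M c' \<le> M a + M b + M c"
    \<comment> \<open>In \<open>descent_step\<close> the first coefficient must be at least the
      second; exchanging \<open>a\<close> and \<open>b\<close> only flips the sign of the
      determinant.\<close>
    proof (cases "T \<le> S")
      case True
      then show thesis using descent_step[of a b c D p S T] p less.prems that by auto
    next
      case False
      have "b + a + c = 0" "det2 b a \<noteq> 0" "D *s p = T *s b + S *s a"
        using less.prems p by (auto simp: det2_swap[of b] add_ac)
      then show thesis using descent_step[of b a c D p T S] p False that
        by (auto simp: det2_swap[of b] add_ac)
    qed
    then have "nat \<bar>det2 a' b'\<bar> < nat \<bar>det2 a b\<bar>" by auto
    from less.hyps[OF this *(1,2)] * show ?thesis by (meson order_trans)
  qed
qed

section \<open>Minimal triples and their reducedness\<close>

lemma minimal_triple: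
  obtains a b c where "a + b + c = 0" "\<bar>det2 a b\<bar> = 1"
    "\<And>a' b' c'. a' + b' + c' = 0 \<Longrightarrow> det2 a' b' \<noteq> 0 \<Longrightarrow> M a + M b + M c \<le> M a' + M b' + M c'"
proof -
  define U where "U = (\<lambda>(a, b, c). a + b + c = (0 :: int ^ 2) \<and> \<bar>det2 a b\<bar> = 1)"
  define V where "V = (\<lambda>(a, b, c). M a + M b + M c)"
  have "U (vector [1, 0], vector [0, 1], vector [- 1, - 1])"
    by (simp add: U_def det2_def vec_eq_iff forall_2)
  from ex_has_least_nat[where P = U and m = "\<lambda>t. nat \<lfloor>V t\<rfloor>", OF this]
  obtain t where t: "U t" "\<And>s. U s \<Longrightarrow> nat \<lfloor>V t\<rfloor> \<le> nat \<lfloor>V s\<rfloor>" by auto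
  \<comment> \<open>Costs are nonnegative integers, so truncating them to naturals to pick a least
    one loses nothing.\<close>
  have V: "V s = real (nat \<lfloor>V s\<rfloor>)" if "U s" for s
  proof -
    have "V s \<in> \<int>" by (auto simp: V_def integral split: prod.split)
    moreover have "0 \<le> V s" using that triple_nonneg by (auto simp: V_def U_def split: prod.splits)
    ultimately show ?thesis by (auto elim!: Ints_cases)
  qed
  have least: "V t \<le> V s" if "U s" for s
    using V[OF t(1)] V[OF that] t(2)[OF that] by linarith
  obtain a b c where [simp]: "t = (a, b, c)" by (cases t)
  show thesis
  proof (rule that)
    show "a + b + c = 0" "\<bar>det2 a b\<bar> = 1" using t(1) by (auto simp: U_def)
    fix a' b' c' :: "int ^ 2" assume "a' + b' + c' = 0" "det2 a' b' \<noteq> 0"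
    \<comment> \<open>Extends minimality from unimodular to all nondegenerate triples.\<close>
    from unimodular_triple_below[OF this] obtain x y z where
      "x + y + z = 0" "\<bar>det2 x y\<bar> = 1" "M x + M y + M z \<le> M a' + M b' + M c'" by blast
    with least[of "(x, y, z)"] show "M a + M b + M c \<le> M a' + M b' + M c'"
      by (auto simp: U_def V_def)
  qed
qed

text \<open>If \<open>wd (a - b) < wd b\<close>, the triple \<open>a\<close>, \<open>- b\<close>, \<open>b - a\<close> would be cheaper than \<open>a\<close>, \<open>b\<close>, \<open>c\<close>.\<close>

lemma wd_diff_ge:
  assumes sum: "a + b + c = 0" and nz: "det2 a b \<noteq> 0"
    and least: "\<And>a' b' c'. a' + b' + c' = 0 \<Longrightarrow> det2 a' b' \<noteq> 0 \<Longrightarrow> M a + M b + M c \<le> M a' + M b' + M c'"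
  shows "wd b \<le> wd (a - b)"
proof -
  have "M a + M b + M c \<le> M a + M (- b) + M (b - a)"
    by (rule least) (use nz in \<open>auto simp: det2_def\<close>)
  \<comment> \<open>The vector \<open>- b\<close> is the midpoint of \<open>a - b\<close> and
    \<open>c\<close>.\<close>
  moreover have "2 * M (- b) \<le> M (a - b) + M c"
  proof -
    have "2 *s (- b) = (a - b) + c"
      using sum by (simp add: vec_eq_iff forall_2)
    then show ?thesis using subadd[of "a - b" c] scale[of 2 "- b"] by simp
  qed
  ultimately show ?thesis by (simp add: wd_def)
qed

text \<open>Permuting a minimal triple keeps it minimal, so it can be sorted by \<open>wd\<close>.
  As \<open>c = - (a + b)\<close>, sorting gives the bound on \<open>a + b\<close>; the bound on
  \<open>a - b\<close> is \<open>wd_diff_ge\<close>.\<close>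

lemma minimal_reduced_triple:
  obtains a b c where "a + b + c = 0" "\<bar>det2 a b\<bar> = 1"
    "\<And>a' b' c'. a' + b' + c' = 0 \<Longrightarrow> det2 a' b' \<noteq> 0 \<Longrightarrow> M a + M b + M c \<le> M a' + M b' + M c'"
    "wd a \<le> wd b" "wd b \<le> wd (a + b)" "wd b \<le> wd (a - b)"
proof -
  define Q where "Q a b c \<longleftrightarrow> a + b + c = 0 \<and> \<bar>det2 a b\<bar> = 1 \<and>
    (\<forall>a' b' c'. a' + b' + c' = 0 \<longrightarrow> det2 a' b' \<noteq> 0 \<longrightarrow> M a + M b + M c \<le> M a' + M b' + M c')"
    for a b c
  note goal = that
  have *: thesis if Q: "Q a b c" and "wd a \<le> wd b" "wd b \<le> wd c" for a b c
  proof (rule goal[of a b c])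
    have "c = - (a + b)" using Q by (metis Q_def add.commute eq_neg_iff_add_eq_0)
    then show "wd b \<le> wd (a + b)" using that(3) by (metis wd_minus)
    show "wd b \<le> wd (a - b)" using Q by (intro wd_diff_ge) (auto simp: Q_def)
  qed (use that in \<open>auto simp: Q_def\<close>)
  obtain a b c where abc: "Q a b c"
    using minimal_triple unfolding Q_def by metis
  have swap: "Q b a c" if "Q a b c" for a b c
    using that unfolding Q_def by (simp add: det2_swap[of b a] add_ac)
  have rot: "Q b c a" if "Q a b c" for a b c
  proof -
    have c: "c = - (a + b)" using that by (metis Q_def add.commute eq_neg_iff_add_eq_0)
    have "det2 b c = det2 a b" by (simp add: c det2_def algebra_simps)
    then show ?thesis using that unfolding Q_def by (simp add: add_ac)
  qed
  note perms = abc rot[OF abc] rot[OF rot[OF abc]] swap[OF abc] swap[OF rot[OF abc]] swap[OF rot[OF rot[OF abc]]]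
  consider "wd a \<le> wd b" "wd b \<le> wd c" | "wd b \<le> wd c" "wd c \<le> wd a" | "wd c \<le> wd a" "wd a \<le> wd b"
    | "wd b \<le> wd a" "wd a \<le> wd c" | "wd c \<le> wd b" "wd b \<le> wd a" | "wd a \<le> wd c" "wd c \<le> wd b"
    by linarith
  then show thesis by cases (rule *; use perms in blast)+
qed

text \<open>Convexity along a line: for positive \<open>n\<close>, \<open>a + b\<close> is the mean
  of \<open>n *s a + b\<close> and \<open>b\<close> with weights \<open>1 / n\<close> and
  \<open>(n - 1) / n\<close>. Negative \<open>n\<close> follows by replacing \<open>a\<close> with
  \<open>- a\<close>.\<close>

lemma wd_add_multiple_ge:
  assumes "wd b \<le> wd (a + b)" "wd b \<le> wd (a - b)"
  shows "wd b \<le> wd (n *s a + b)"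
proof -
  have pos: "wd b \<le> wd (n *s a + b)" if "0 \<le> n" "wd b \<le> wd (a + b)" for n a
  proof (cases "n = 0")
    case False
    have "n *s (a + b) = (n *s a + b) + (n - 1) *s b"
      by (simp add: vec_eq_iff algebra_simps)
    then have "of_int n * wd (a + b) \<le> wd (n *s a + b) + of_int (n - 1) * wd b"
      using wd_scale[of n "a + b"] wd_scale[of "n - 1" b] wd_subadd[of "n *s a + b" "(n - 1) *s b"]
        that False by simp
    moreover have "of_int n * wd b \<le> of_int n * wd (a + b)"
      using that by (intro mult_left_mono) auto
    ultimately show ?thesis by (simp add: algebra_simps)
  qed simp
  show ?thesis
  proof (cases "0 \<le> n")
    case False
    then show ?thesis using pos[of "- n" "- a"] assms wd_minus_commute[of a b]
      by (simp add: vector_smult_lneg)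
  qed (use pos assms in auto)
qed

end

section \<open>Support functions and lattice size\<close>

definition support :: "(real ^ 'n) set \<Rightarrow> real ^ 'n \<Rightarrow> real" where
  "support P h = (SUP x\<in>P. h \<bullet> x)"

lemma support_upper: "compact P \<Longrightarrow> x \<in> P \<Longrightarrow> h \<bullet> x \<le> support P h"
  unfolding support_def
  by (intro cSUP_upper bounded_imp_bdd_above compact_imp_bounded compact_continuous_image
      continuous_intros)

lemma support_least: "P \<noteq> {} \<Longrightarrow> (\<And>x. x \<in> P \<Longrightarrow> h \<bullet> x \<le> c) \<Longrightarrow> support P h \<le> c"
  unfolding support_def by (rule cSUP_least)

lemma support_attained:
  assumes "compact P" "P \<noteq> {}"
  obtains x where "x \<in> P" "h \<bullet> x = support P h"
proof -
  have "continuous_on P (\<lambda>x. h \<bullet> x)" by (intro continuous_intros)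
  from continuous_attains_sup[OF assms this] obtain x where
    x: "x \<in> P" "\<And>y. y \<in> P \<Longrightarrow> h \<bullet> y \<le> h \<bullet> x" by blast
  then have "h \<bullet> x = support P h"
    using assms by (intro antisym support_upper support_least) auto
  with x show thesis using that by blast
qed

lemma width_eq_support: "width h P = support P h + support P (- h)"
  by (simp add: width_def support_def Inf_real_def image_image)

lemma width_nonneg:
  assumes "compact P" "P \<noteq> {}"
  shows "0 \<le> width h P"
proof -
  obtain x where "x \<in> P" using assms by blast
  then show ?thesis
    using support_upper[OF assms(1), of x h] support_upper[OF assms(1), of x "- h"]
    by (simp add: width_eq_support)
qed

lemma support_add:
  assumes "compact P" "P \<noteq> {}"
  shows "support P (a + b) \<le> support P a + support P b"
proof (rule support_least)
  fix x assume "x \<in> P"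
  then show "(a + b) \<bullet> x \<le> support P a + support P b"
    using support_upper[OF assms(1), of x a] support_upper[OF assms(1), of x b]
    by (simp add: inner_add_left)
qed (rule assms)

lemma support_scaleR:
  assumes "compact P" "P \<noteq> {}" "0 \<le> c"
  shows "support P (c *\<^sub>R a) = c * support P a"
proof (rule antisym)
  show "support P (c *\<^sub>R a) \<le> c * support P a"
    using assms by (intro support_least) (auto intro!: mult_left_mono support_upper)
  obtain x where "x \<in> P" "a \<bullet> x = support P a" using assms by (rule_tac support_attained)
  then show "c * support P a \<le> support P (c *\<^sub>R a)"
    using support_upper[OF assms(1), of x "c *\<^sub>R a"] by simp
qed

section \<open>Integral functionals on lattice polytopes\<close>

lemma of_int_vec_nth [simp]: "of_int_vec v $ i = real_of_int (v $ i)"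
  by (simp add: of_int_vec_def)

lemma of_int_vec_simps [simp]:
  "of_int_vec (a + b) = of_int_vec a + of_int_vec b"
  "of_int_vec (a - b) = of_int_vec a - of_int_vec b"
  "of_int_vec (- a) = - of_int_vec a"
  "of_int_vec (n *s a) = of_int n *\<^sub>R of_int_vec a"
  "of_int_vec 0 = 0"
  by (simp_all add: vec_eq_iff)

lemma inner_int_lattice: "x \<in> int_lattice \<Longrightarrow> of_int_vec h \<bullet> x \<in> \<int>"
  by (auto simp: int_lattice_def inner_vec_def)

lemma lattice_polytopeD:
  assumes "lattice_polytope P"
  shows "compact P" "convex P" "P \<noteq> {}" "\<And>x. x extreme_point_of P \<Longrightarrow> x \<in> int_lattice"
  using assms by (auto simp: lattice_polytope_def polytope_imp_compact polytope_imp_convex)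

text \<open>The maximum is attained on a face; an extreme point of that face is a vertex of
  \<open>P\<close>, hence a lattice point.\<close>

lemma support_integral:
  assumes "lattice_polytope P"
  shows "support P (of_int_vec h) \<in> \<int>"
proof -
  note P = lattice_polytopeD[OF assms]
  define F where "F = P \<inter> {x. of_int_vec h \<bullet> x = support P (of_int_vec h)}"
  have face: "F face_of P"
    unfolding F_def using P by (intro face_of_Int_supporting_hyperplane_le support_upper)
  have "F \<noteq> {}" using support_attained[OF P(1,3), of "of_int_vec h"] by (auto simp: F_def)
  moreover have "compact F" "convex F"
    using face P face_of_imp_compact face_of_imp_convex by blast+
  ultimately obtain x where "x extreme_point_of F" by (metis extreme_point_exists_convex)
  with face have "x \<in> int_lattice" "x \<in> F"
    using P(4) by (auto simp: extreme_point_of_face)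
  then show ?thesis using inner_int_lattice[of x h] by (simp add: F_def)
qed

lemma integral_sublinear_support:
  assumes "lattice_polytope P"
  shows "integral_sublinear (\<lambda>h. support P (of_int_vec h))"
  using lattice_polytopeD[OF assms] support_integral[OF assms]
  by unfold_locales (simp_all add: support_add support_scaleR)

section \<open>Dilated simplices and the two lattice sizes\<close>

lemma mem_dilated_simplex:
  fixes x :: "real ^ 'n"
  assumes "0 \<le> l"
  shows "x \<in> (\<lambda>x. l *\<^sub>R x) ` standard_simplex \<longleftrightarrow> (\<forall>i. 0 \<le> x $ i) \<and> (\<Sum>i\<in>UNIV. x $ i) \<le> l"
proof -
  have B: "Basis = range (\<lambda>i. axis i 1 :: real ^ 'n)"
    by (auto simp: Basis_vec_def)
  have inj: "inj (\<lambda>i. axis i 1 :: real ^ 'n)"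
    by (auto simp: inj_def axis_eq_axis)
  have simplex: "y \<in> standard_simplex \<longleftrightarrow> (\<forall>i. 0 \<le> y $ i) \<and> (\<Sum>i\<in>UNIV. y $ i) \<le> 1" for y :: "real ^ 'n"
    using std_simplex[where 'a = "real ^ 'n"]
    by (simp add: standard_simplex_def B sum.reindex[OF inj] inner_axis)
  show ?thesis
  proof (cases "l = 0")
    case True
    \<comment> \<open>Division by \<open>l\<close> is impossible here; the inequalities leave only
      the origin.\<close>
    have "x = 0" if "\<forall>i. 0 \<le> x $ i" "(\<Sum>i\<in>UNIV. x $ i) \<le> 0"
      using that sum_nonneg_eq_0_iff[of UNIV "\<lambda>i. x $ i"] sum_nonneg[of UNIV "\<lambda>i. x $ i"]
      by (simp add: vec_eq_iff)
    moreover have "0 \<in> (standard_simplex :: (real ^ 'n) set)" by (simp add: simplex)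
    ultimately show ?thesis using True by (auto simp: image_iff)
  next
    case False
    then have l: "0 < l" using assms by simp
    have "x \<in> (\<lambda>x. l *\<^sub>R x) ` standard_simplex \<longleftrightarrow> (1 / l) *\<^sub>R x \<in> standard_simplex"
      using l by (auto simp: image_iff intro!: bexI[of _ "(1 / l) *\<^sub>R x"])
    also have "\<dots> \<longleftrightarrow> (\<forall>i. 0 \<le> x $ i) \<and> (\<Sum>i\<in>UNIV. x $ i) \<le> l"
      using l by (simp add: simplex zero_le_divide_iff flip: sum_divide_distrib)
    finally show ?thesis .
  qed
qed

lemma int_matrix_vector_nth: "(map_matrix real_of_int A *v x) $ i = of_int_vec (A $ i) \<bullet> x"
  by (simp add: matrix_vector_mult_def inner_vec_def)

text \<open>The least \<open>l\<close> for which some real translate of \<open>A P\<close> lies in the \<open>l\<close>-dilate of the standard simplex.\<close>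

definition simplex_bound :: "int ^ 'n ^ 'n \<Rightarrow> (real ^ 'n) set \<Rightarrow> real" where
  "simplex_bound A P =
     (\<Sum>i\<in>UNIV. support P (- of_int_vec (A $ i))) + support P (\<Sum>i\<in>UNIV. of_int_vec (A $ i))"

text \<open>Nonnegative coordinates bound each \<open>h $ i\<close> from below, the coordinate sum
  bounds their total from above; adding up eliminates the translation.\<close>

lemma simplex_bound_le:
  assumes "P \<noteq> {}" "0 \<le> l"
    and "(\<lambda>x. map_matrix real_of_int A *v x + of_int_vec h) ` P \<subseteq> (\<lambda>x. l *\<^sub>R x) ` standard_simplex"
  shows "simplex_bound A P \<le> l"
proof -
  have *: "0 \<le> of_int_vec (A $ i) \<bullet> x + of_int (h $ i)"
    "(\<Sum>i\<in>UNIV. of_int_vec (A $ i) \<bullet> x + of_int (h $ i)) \<le> l" if "x \<in> P" for x i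
    using that assms(3) by (auto simp: image_subset_iff mem_dilated_simplex[OF assms(2)] int_matrix_vector_nth)
  have "(\<Sum>i\<in>UNIV. support P (- of_int_vec (A $ i))) \<le> (\<Sum>i\<in>UNIV. of_int (h $ i))"
  proof (intro sum_mono support_least assms(1))
    fix i x assume "x \<in> P"
    from *(1)[OF this, of i] show "- of_int_vec (A $ i) \<bullet> x \<le> of_int (h $ i)" by simp
  qed
  moreover have "support P (\<Sum>i\<in>UNIV. of_int_vec (A $ i)) \<le> l - (\<Sum>i\<in>UNIV. of_int (h $ i))"
    using *(2) by (intro support_least assms(1)) (force simp: inner_sum_left sum.distrib algebra_simps)
  ultimately show ?thesis by (simp add: simplex_bound_def)
qed

lemma simplex_bound_attained:
  assumes P: "compact P" "P \<noteq> {}" and int: "\<And>i. support P (- of_int_vec (A $ i)) \<in> \<int>"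
  obtains h where "0 \<le> simplex_bound A P"
    "(\<lambda>x. map_matrix real_of_int A *v x + of_int_vec h) ` P
       \<subseteq> (\<lambda>x. simplex_bound A P *\<^sub>R x) ` standard_simplex"
proof -
  \<comment> \<open>The supports are integers, so the floor changes nothing and the optimal
    translation is a lattice translation.\<close>
  define h where "h = (\<chi> i. \<lfloor>support P (- of_int_vec (A $ i))\<rfloor>)"
  have h: "of_int (h $ i) = support P (- of_int_vec (A $ i))" for i
    using int[of i] by (auto simp: h_def elim!: Ints_cases)
  have *: "0 \<le> of_int_vec (A $ i) \<bullet> x + of_int (h $ i)"
    "(\<Sum>i\<in>UNIV. of_int_vec (A $ i) \<bullet> x + of_int (h $ i)) \<le> simplex_bound A P" if "x \<in> P" for x i
    using support_upper[OF P(1) that, of "- of_int_vec (A $ i)"]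
      support_upper[OF P(1) that, of "\<Sum>i\<in>UNIV. of_int_vec (A $ i)"]
    by (simp_all add: h simplex_bound_def inner_sum_left sum.distrib)
  obtain x where "x \<in> P" using P by blast
  then have "0 \<le> simplex_bound A P"
    using *(1)[of x] *(2)[of x] by (meson order_trans sum_nonneg)
  moreover from this have "(\<lambda>x. map_matrix real_of_int A *v x + of_int_vec h) ` P
      \<subseteq> (\<lambda>x. simplex_bound A P *\<^sub>R x) ` standard_simplex"
    using * by (auto simp: mem_dilated_simplex int_matrix_vector_nth)
  ultimately show thesis by (rule that)
qed

lemma det_nonzero_if_invertible:
  fixes A :: "int ^ 'n ^ 'n"
  assumes "invertible A"
  shows "det A \<noteq> 0"
proof -
  obtain B where "A ** B = mat 1" using assms by (auto simp: invertible_def)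
  then have "det A * det B = 1" by (simp flip: det_mul)
  then show ?thesis by auto
qed

text \<open>The competitors are all matrices of nonzero determinant, the form in which minimality of
  triples is available; every unimodular matrix is among them.\<close>

lemma lattice_size_eq:
  assumes "compact P" "P \<noteq> {}" "invertible A" "\<And>i. support P (- of_int_vec (A $ i)) \<in> \<int>"
    and "\<And>B. det B \<noteq> 0 \<Longrightarrow> simplex_bound A P \<le> simplex_bound B P"
  shows "lattice_size P = simplex_bound A P"
  unfolding lattice_size_def
proof (rule Least_equality)
  obtain h where h: "0 \<le> simplex_bound A P"
    "(\<lambda>x. map_matrix real_of_int A *v x + of_int_vec h) ` P
       \<subseteq> (\<lambda>x. simplex_bound A P *\<^sub>R x) ` standard_simplex"
    using simplex_bound_attained[OF assms(1,2,4)] .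
  have "(\<lambda>x. map_matrix real_of_int A *v x + of_int_vec h) \<in> AGL_int"
    unfolding AGL_int_def using assms(3) by blast
  with h show "0 \<le> simplex_bound A P \<and>
      (\<exists>T\<in>AGL_int. T ` P \<subseteq> (\<lambda>x. simplex_bound A P *\<^sub>R x) ` standard_simplex)" by blast
next
  fix l assume "0 \<le> l \<and> (\<exists>T\<in>AGL_int. T ` P \<subseteq> (\<lambda>x. l *\<^sub>R x) ` standard_simplex)"
  then obtain T where l: "0 \<le> l" and T: "T \<in> AGL_int"
    and image: "T ` P \<subseteq> (\<lambda>x. l *\<^sub>R x) ` standard_simplex" by blast
  from T obtain B h where B: "invertible B"
    and T_eq: "T = (\<lambda>x. map_matrix real_of_int B *v x + of_int_vec h)"
    unfolding AGL_int_def by blast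
  show "simplex_bound A P \<le> l"
    using assms(5)[OF det_nonzero_if_invertible[OF B]]
      simplex_bound_le[OF assms(2) l image[unfolded T_eq]] by linarith
qed

text \<open>The identity attains the bound. Any sign matrix \<open>D\<close> leads to
  \<open>D ** A\<close>, again of nonzero determinant and therefore no cheaper.\<close>

lemma naive_lattice_size_image_eq:
  assumes "compact P" "P \<noteq> {}" "invertible A" "\<And>i. support P (- of_int_vec (A $ i)) \<in> \<int>"
    and "\<And>B. det B \<noteq> 0 \<Longrightarrow> simplex_bound A P \<le> simplex_bound B P"
  shows "naive_lattice_size (int_mat_image A P) = simplex_bound A P"
  unfolding naive_lattice_size_def
proof (rule Least_equality)
  obtain h where h: "0 \<le> simplex_bound A P"
    "(\<lambda>x. map_matrix real_of_int A *v x + of_int_vec h) ` P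
       \<subseteq> (\<lambda>x. simplex_bound A P *\<^sub>R x) ` standard_simplex"
    using simplex_bound_attained[OF assms(1,2,4)] .
  have "(\<lambda>x. map_matrix real_of_int (mat 1) *v x + of_int_vec h) \<in> signed_translations"
    unfolding signed_translations_def
    by (rule CollectI, rule exI[of _ "mat 1"], rule exI[of _ h]) (simp add: mat_def)
  moreover have "map_matrix real_of_int (mat 1) = (mat 1 :: real ^ 'a ^ 'a)"
    by (simp add: vec_eq_iff mat_def)
  ultimately have "(\<lambda>x. x + of_int_vec h) \<in> (signed_translations :: (real ^ 'a \<Rightarrow> real ^ 'a) set)" by simp
  with h show "0 \<le> simplex_bound A P \<and> (\<exists>T\<in>signed_translations.
      T ` int_mat_image A P \<subseteq> (\<lambda>x. simplex_bound A P *\<^sub>R x) ` standard_simplex)"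
    by (intro conjI bexI[of _ "\<lambda>x. x + of_int_vec h"]) (simp_all add: int_mat_image_def image_image)
next
  fix l assume "0 \<le> l \<and> (\<exists>T\<in>signed_translations.
      T ` int_mat_image A P \<subseteq> (\<lambda>x. l *\<^sub>R x) ` standard_simplex)"
  then obtain T where l: "0 \<le> l" and T: "T \<in> signed_translations"
    and image: "T ` int_mat_image A P \<subseteq> (\<lambda>x. l *\<^sub>R x) ` standard_simplex" by blast
  from T obtain D h where D: "\<And>i j. i \<noteq> j \<Longrightarrow> D $ i $ j = 0" "\<And>i. D $ i $ i = 1 \<or> D $ i $ i = - 1"
    and T_eq: "T = (\<lambda>x. map_matrix real_of_int D *v x + of_int_vec h)"
    unfolding signed_translations_def by blast
  note sub = image[unfolded T_eq]
  have "map_matrix real_of_int D *v (map_matrix real_of_int A *v x)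
      = map_matrix real_of_int (D ** A) *v x" for x
    by (simp add: matrix_vector_mul_assoc) (simp add: matrix_matrix_mult_def map_matrix_def)
  with sub have "(\<lambda>x. map_matrix real_of_int (D ** A) *v x + of_int_vec h) ` P
      \<subseteq> (\<lambda>x. l *\<^sub>R x) ` standard_simplex"
    by (simp add: int_mat_image_def image_image)
  then have "simplex_bound (D ** A) P \<le> l" by (rule simplex_bound_le[OF assms(2) l])
  moreover have "det (D ** A) \<noteq> 0"
  proof -
    have "D $ i $ i \<noteq> 0" for i using D(2)[of i] by auto
    then have "det D \<noteq> 0" by (simp add: det_diagonal D(1))
    then show ?thesis using det_nonzero_if_invertible[OF assms(3)] by (simp add: det_mul)
  qed
  ultimately show "simplex_bound A P \<le> l" using assms(5)[of "D ** A"] by linarith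
qed

section \<open>Polytopes of width one\<close>

text \<open>Polymorphic because it projects points and integral functionals alike: on the plane x =
  0, a functional \<open>r\<close> acts as \<open>yz_part r\<close>.\<close>

definition yz_part :: "'a ^ 3 \<Rightarrow> 'a::zero ^ 2" where
  "yz_part p = vector [p $ 2, p $ 3]"

lemma yz_part_nth [simp]: "yz_part p $ 1 = p $ 2" "yz_part p $ 2 = p $ 3"
  by (simp_all add: yz_part_def)

lemma yz_part_of_int_vec: "yz_part (of_int_vec r) = of_int_vec (yz_part r)"
  by (simp add: vec_eq_iff forall_2)

lemma x_slice_eq: "x_slice t P = yz_part ` (P \<inter> {p. p $ 1 = t})"
  by (simp add: x_slice_def yz_part_def)

text \<open>The lower bound \<open>t\<close> makes the section a face, so its vertices are vertices
  of \<open>P\<close>, and they project to lattice points.\<close>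

lemma lattice_polytope_x_slice:
  assumes P: "lattice_polytope P" and t: "\<And>p. p \<in> P \<Longrightarrow> t \<le> p $ 1" and ne: "x_slice t P \<noteq> {}"
  shows "lattice_polytope (x_slice t P)"
proof -
  define F where "F = P \<inter> {p. p $ 1 = t}"
  define E where "E = {p. p extreme_point_of F}"
  have lin: "linear (yz_part :: real ^ 3 \<Rightarrow> _)"
    by (rule linearI) (simp_all add: vec_eq_iff forall_2)
  have "P \<inter> {p. axis 1 1 \<bullet> p = t} face_of P"
    using t lattice_polytopeD[OF P] by (intro face_of_Int_supporting_hyperplane_ge) (auto simp: inner_axis')
  then have face: "F face_of P" by (simp add: F_def inner_axis')
  have polyF: "polytope F"
    using face_of_polytope_polytope[OF _ face] P by (simp add: lattice_polytope_def)
  then have "F = convex hull E"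
    unfolding E_def by (intro Krein_Milman_Minkowski polytope_imp_compact polytope_imp_convex)
  then have slice: "x_slice t P = convex hull (yz_part ` E)"
    by (simp add: x_slice_eq F_def[symmetric] convex_hull_linear_image[OF lin])
  have "E \<subseteq> int_lattice"
    using lattice_polytopeD(4)[OF P] extreme_point_of_face[OF face] by (auto simp: E_def)
  then have "yz_part ` E \<subseteq> int_lattice"
    by (auto simp: int_lattice_def yz_part_of_int_vec)
  then have "{q. q extreme_point_of x_slice t P} \<subseteq> int_lattice"
    using extreme_points_of_convex_hull[of "yz_part ` E"] by (auto simp: slice)
  moreover have "polytope (x_slice t P)"
    using polytope_linear_image[OF lin polyF] by (simp add: x_slice_eq F_def)
  ultimately show ?thesis using ne by (simp add: lattice_polytope_def)
qed

text \<open>At an interior lattice point a nonzero functional stays strictly below its maximum. Both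
  values are integers, whence the gap of 1, and a halfspace bound passes to the convex hull.\<close>

lemma inner_interior_lattice_hull_le:
  assumes S: "lattice_polytope S" and h: "h \<noteq> 0"
    and q: "q \<in> convex hull (interior S \<inter> int_lattice)"
  shows "of_int_vec h \<bullet> q \<le> support S (of_int_vec h) - 1"
proof -
  let ?h = "of_int_vec h"
  have "?h \<bullet> q \<le> support S ?h - 1" if q: "q \<in> interior S" "q \<in> int_lattice" for q
  proof -
    have h0: "?h \<noteq> 0" using h by (simp add: vec_eq_iff)
    obtain e where e: "0 < e" "cball q e \<subseteq> S" using q(1) by (auto simp: mem_interior_cball)
    have "q + (e / norm ?h) *\<^sub>R ?h \<in> cball q e"
      using e h0 by (simp add: dist_norm)
    then have "?h \<bullet> (q + (e / norm ?h) *\<^sub>R ?h) \<le> support S ?h"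
      using e by (intro support_upper lattice_polytopeD[OF S]) auto
    moreover have "0 < (e / norm ?h) * (?h \<bullet> ?h)" using e h0 by simp
    ultimately have "?h \<bullet> q < support S ?h" by (simp add: inner_add_right)
    moreover obtain m n where "?h \<bullet> q = of_int m" "support S ?h = of_int n"
      using inner_int_lattice[OF q(2)] support_integral[OF S, of h] by (metis Ints_cases)
    ultimately show ?thesis by simp
  qed
  then have "convex hull (interior S \<inter> int_lattice) \<subseteq> {q. ?h \<bullet> q \<le> support S ?h - 1}"
    by (intro hull_minimal convex_halfspace_le) auto
  with q show ?thesis by blast
qed

section \<open>Unimodular matrices and bases of the integer lattice\<close>

lemma invertible_int_2:
  fixes a b :: "int ^ 2"
  assumes "\<bar>det2 a b\<bar> = 1"
  shows "invertible (vector [- a, - b] :: int ^ 2 ^ 2)"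
proof -
  define d where "d = det2 a b"
  have d: "d * d = 1" using assms unfolding d_def by (simp add: abs_square_eq_1 flip: power2_eq_square)
  \<comment> \<open>The adjugate times \<open>d\<close>, which is its own inverse since
    \<open>d * d = 1\<close>.\<close>
  define B :: "int ^ 2 ^ 2" where
    "B = vector [vector [- d * b $ 2, d * a $ 2], vector [d * b $ 1, - d * a $ 1]]"
  have "d * (a $ 1 * b $ 2) - d * (a $ 2 * b $ 1) = 1"
    using d by (simp add: d_def det2_def algebra_simps)
  then have "vector [- a, - b] ** B = mat 1" "B ** vector [- a, - b] = mat 1"
    by (simp_all add: B_def vec_eq_iff forall_2 matrix_matrix_mult_def sum_2 mat_def algebra_simps)
  then show ?thesis unfolding invertible_def by blast
qed

lemma invertible_int_3:
  fixes a b :: "int ^ 3"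
  assumes "\<bar>det2 (yz_part a) (yz_part b)\<bar> = 1"
  shows "invertible (vector [vector [1, 0, 0], a, b] :: int ^ 3 ^ 3)"
proof -
  define d where "d = det2 (yz_part a) (yz_part b)"
  have d: "d * d = 1" using assms unfolding d_def by (simp add: abs_square_eq_1 flip: power2_eq_square)
  \<comment> \<open>The first row makes \<open>d\<close> the full determinant, so this is again the
    adjugate times \<open>d\<close>.\<close>
  define B :: "int ^ 3 ^ 3" where
    "B = vector [vector [1, 0, 0],
       vector [d * (a $ 3 * b $ 1 - a $ 1 * b $ 3), d * b $ 3, - d * a $ 3],
       vector [d * (a $ 1 * b $ 2 - a $ 2 * b $ 1), - d * b $ 2, d * a $ 2]]"
  have *: "d * (a $ 2 * b $ 3) = 1 + d * (a $ 3 * b $ 2)"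
    using d by (simp add: d_def det2_def algebra_simps)
  \<comment> \<open>The same identity with a spare factor, for the cubic terms of the matrix
    product.\<close>
  have **: "d * (x * (a $ 2 * b $ 3)) = x + d * (x * (a $ 3 * b $ 2))" for x
    using arg_cong[OF *, of "(*) x"] by (simp add: algebra_simps)
  have "vector [vector [1, 0, 0], a, b] ** B = mat 1" "B ** vector [vector [1, 0, 0], a, b] = mat 1"
    by (simp_all add: B_def vec_eq_iff forall_3 matrix_matrix_mult_def sum_3 mat_def algebra_simps * **)
  then show ?thesis unfolding invertible_def by blast
qed

lemma int_basis_if_invertible:
  assumes "invertible (vector [h1, h2, h3] :: int ^ 3 ^ 3)"
  shows "int_basis h1 h2 h3"
proof -
  define A :: "int ^ 3 ^ 3" where "A = vector [h1, h2, h3]"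
  obtain B where B: "A ** B = mat 1" "B ** A = mat 1" using assms by (auto simp: A_def invertible_def)
  have comb: "vector [a, b, c] v* A = a *s h1 + b *s h2 + c *s h3" for a b c
    by (simp add: vec_eq_iff A_def vector_matrix_mult_def sum_3 algebra_simps)
  show ?thesis
    unfolding int_basis_def
  proof (intro allI ex1I)
    fix v :: "int ^ 3"
    have w: "vector [(v v* B) $ 1, (v v* B) $ 2, (v v* B) $ 3] = v v* B"
      by (simp add: vec_eq_iff forall_3)
    have "v = (v v* B) v* A" by (simp add: vector_matrix_mul_assoc B)
    then show "case ((v v* B) $ 1, (v v* B) $ 2, (v v* B) $ 3) of
        (a, b, c) \<Rightarrow> v = a *s h1 + b *s h2 + c *s h3"
      by (simp add: w flip: comb)
    fix x assume "case x of (a, b, c) \<Rightarrow> v = a *s h1 + b *s h2 + c *s h3"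
    then obtain a b c where x: "x = (a, b, c)" "v = vector [a, b, c] v* A"
      by (auto simp: comb split: prod.splits)
    then have "v v* B = vector [a, b, c]" by (simp add: vector_matrix_mul_assoc B)
    then show "x = ((v v* B) $ 1, (v v* B) $ 2, (v v* B) $ 3)" by (simp add: x(1))
  qed
qed

section \<open>Lifting planar functionals to the slab\<close>

locale width_one_polytope =
  fixes P :: "(real ^ 3) set" and v :: "int ^ 2"
  assumes lattice: "lattice_polytope P"
    and slab: "P \<subseteq> {p. 0 \<le> p $ 1 \<and> p $ 1 \<le> 1}"
    and top_nonempty: "x_slice 1 P \<noteq> {}"
    and top_inside: "(\<lambda>q. q + of_int_vec v) ` x_slice 1 P
      \<subseteq> convex hull (interior (x_slice 0 P) \<inter> int_lattice)"
begin

abbreviation S :: "(real ^ 2) set" where "S \<equiv> x_slice 0 P"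

abbreviation M :: "int ^ 2 \<Rightarrow> real" where "M h \<equiv> support S (of_int_vec h)"

abbreviation N :: "int ^ 3 \<Rightarrow> real" where "N r \<equiv> support P (of_int_vec r)"

lemmas P = lattice_polytopeD[OF lattice]

lemma slice_lattice: "lattice_polytope S"
proof -
  have "S \<noteq> {}"
    using top_nonempty top_inside interior_subset by fastforce
  then show ?thesis using lattice slab by (intro lattice_polytope_x_slice) auto
qed

lemmas S = lattice_polytopeD[OF slice_lattice]

sublocale integral_sublinear M
  by (rule integral_sublinear_support[OF slice_lattice])

text \<open>The functional that equals \<open>h\<close> on the slice at \<open>0\<close> and the pullback of \<open>h\<close> along the
  translation by \<open>v\<close>, plus \<open>k\<close>, on the slice at \<open>1\<close>.\<close>

definition lift :: "int \<Rightarrow> int ^ 2 \<Rightarrow> int ^ 3" where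
  "lift k h = vector [v $ 1 * h $ 1 + v $ 2 * h $ 2 + k, h $ 1, h $ 2]"

lemma yz_part_lift [simp]: "yz_part (lift k h) = h"
  by (simp add: lift_def vec_eq_iff forall_2)

lemma lift_simps:
  "lift k a + lift l b = lift (k + l) (a + b)"
  "lift k a - lift l b = lift (k - l) (a - b)"
  "- lift k a = lift (- k) (- a)"
  "m *s lift k a = lift (m * k) (m *s a)"
  by (simp_all add: lift_def vec_eq_iff forall_3 algebra_simps)

lemma support_slice_le: "M (yz_part r) \<le> N r"
proof (rule support_least)
  fix q assume "q \<in> S"
  then obtain p where p: "p \<in> P" "p $ 1 = 0" "q = yz_part p" by (auto simp: x_slice_eq)
  then show "of_int_vec (yz_part r) \<bullet> q \<le> N r"
    using support_upper[OF P(1) p(1), of "of_int_vec r"] by (simp add: inner_vec_def sum_2 sum_3)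
qed (rule S)

text \<open>Only vertices matter, and they have x = 0 or x = 1. On the first kind the functional is
  \<open>h\<close>; on the second it is \<open>h\<close> at the translated point plus
  \<open>k\<close>, and the loss of at least 1 there absorbs \<open>k \<le> 1\<close>.\<close>

lemma support_lift:
  assumes "h \<noteq> 0" "k \<le> 1"
  shows "N (lift k h) = M h"
proof (rule antisym)
  have "of_int_vec (lift k h) \<bullet> p \<le> M h" if ext: "p extreme_point_of P" for p
  proof -
    have p: "p \<in> P" "p \<in> int_lattice" using ext P by (auto simp: extreme_point_of_def)
    then obtain w where w: "p = of_int_vec w" by (auto simp: int_lattice_def)
    have "0 \<le> w $ 1" "w $ 1 \<le> 1" using slab p w by auto
    then consider "p $ 1 = 0" | "p $ 1 = 1" using w by force
    then show ?thesis
    proof cases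
      case 1
      then have "yz_part p \<in> S" using p by (auto simp: x_slice_eq)
      from support_upper[OF S(1) this, of "of_int_vec h"] 1 show ?thesis
        by (simp add: inner_vec_def sum_2 sum_3 lift_def)
    next
      case 2
      then have "yz_part p \<in> x_slice 1 P" using p by (auto simp: x_slice_eq)
      then have "yz_part p + of_int_vec v \<in> convex hull (interior S \<inter> int_lattice)"
        using top_inside by blast
      from inner_interior_lattice_hull_le[OF slice_lattice assms(1) this] 2 assms(2) show ?thesis
        by (simp add: inner_vec_def sum_2 sum_3 lift_def algebra_simps)
    qed
  qed
  then have "convex hull {p. p extreme_point_of P} \<subseteq> {p. of_int_vec (lift k h) \<bullet> p \<le> M h}"
    by (intro hull_minimal convex_halfspace_le) auto
  then show "N (lift k h) \<le> M h"
    using Krein_Milman_Minkowski[OF P(1,2)] by (intro support_least P(3)) auto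
  show "M h \<le> N (lift k h)" using support_slice_le[of "lift k h"] by simp
qed

text \<open>The functional \<open>lift 1 0\<close> is the coordinate x, the case
  \<open>h = 0\<close> outside \<open>support_lift\<close>; both its extremes are attained because
  both slices are nonempty.\<close>

lemma support_lift_0: "N (lift 1 0) = 1" "N (lift (- 1) 0) = 0"
proof -
  obtain p where p: "p \<in> P" "p $ 1 = 1" using top_nonempty by (auto simp: x_slice_eq)
  obtain q where q: "q \<in> P" "q $ 1 = 0" using S(3) by (auto simp: x_slice_eq)
  show "N (lift 1 0) = 1"
    using slab support_upper[OF P(1) p(1), of "of_int_vec (lift 1 0)"] p
    by (intro antisym support_least P(3)) (auto simp: inner_vec_def sum_3 lift_def)
  show "N (lift (- 1) 0) = 0"
    using slab support_upper[OF P(1) q(1), of "of_int_vec (lift (- 1) 0)"] q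
    by (intro antisym support_least P(3)) (auto simp: inner_vec_def sum_3 lift_def)
qed

lemma width_lift:
  assumes "h \<noteq> 0" "\<bar>k\<bar> \<le> 1"
  shows "width (of_int_vec (lift k h)) P = wd h"
  using support_lift[of h k] support_lift[of "- h" "- k"] assms
  by (simp add: width_eq_support wd_def lift_simps flip: of_int_vec_simps(3))

lemma width_ge: "wd (yz_part r) \<le> width (of_int_vec r) P"
proof -
  have "yz_part (- r) = - yz_part r" by (simp add: vec_eq_iff forall_2)
  then show ?thesis using support_slice_le[of r] support_slice_le[of "- r"]
    by (simp add: width_eq_support wd_def)
qed

text \<open>A point of the inner hull loses at least 1 against both \<open>h\<close> and
  \<open>- h\<close>. Hence the coordinate x, of width 1, can come first in the reduced
  basis.\<close>

lemma wd_ge_2: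
  assumes "h \<noteq> 0"
  shows "2 \<le> wd h"
proof -
  obtain q where "q \<in> convex hull (interior S \<inter> int_lattice)" using top_nonempty top_inside by blast
  then show ?thesis
    using inner_interior_lattice_hull_le[OF slice_lattice, of h q]
      inner_interior_lattice_hull_le[OF slice_lattice, of "- h" q] assms
    by (simp add: wd_def)
qed

theorem sizes_and_reduced_basis:
  "lattice_size P = lattice_size S \<and>
    (\<exists>h1 h2 h3. reduced_basis P h1 h2 h3 \<and> computes_lattice_size P h1 h2 h3)"
proof -
  obtain a b c where sum: "a + b + c = 0" and det: "\<bar>det2 a b\<bar> = 1"
    and least: "\<And>a' b' c'. a' + b' + c' = 0 \<Longrightarrow> det2 a' b' \<noteq> 0 \<Longrightarrow> M a + M b + M c \<le> M a' + M b' + M c'"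
    and wd: "wd a \<le> wd b" "wd b \<le> wd (a + b)" "wd b \<le> wd (a - b)"
    by (rule minimal_reduced_triple) blast
  have c: "c = - a - b" using sum by (simp add: algebra_simps eq_neg_iff_add_eq_0)
  have nz: "a \<noteq> 0" "b \<noteq> 0" "c \<noteq> 0"
    using det by (auto simp: c det2_def algebra_simps)
  define L where "L = M a + M b + M c"
  \<comment> \<open>Since \<open>simplex_bound\<close> evaluates supports at negated rows, the rows
    are \<open>- a\<close> and \<open>- b\<close>; their sum is \<open>c\<close>.\<close>
  define A2 :: "int ^ 2 ^ 2" where "A2 = vector [- a, - b]"
  define h1 h2 h3 where "h1 = lift 1 0" and "h2 = lift 0 (- a)" and "h3 = lift 0 (- b)"
  define A3 :: "int ^ 3 ^ 3" where "A3 = vector [h1, h2, h3]"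

  have bound2: "simplex_bound A2 S = L"
    by (simp add: simplex_bound_def A2_def sum_2 L_def c)
  have least2: "L \<le> simplex_bound B S" if "det B \<noteq> 0" for B :: "int ^ 2 ^ 2"
  proof -
    have "L \<le> M (- (B $ 1)) + M (- (B $ 2)) + M (B $ 1 + B $ 2)"
      unfolding L_def by (rule least) (use that in \<open>auto simp: det_2 det2_def\<close>)
    then show ?thesis by (simp add: simplex_bound_def sum_2)
  qed
  have inv2: "invertible A2" unfolding A2_def by (rule invertible_int_2[OF det])
  have size2: "lattice_size S = L"
    using lattice_size_eq[OF S(1,3) inv2] bound2 least2 support_integral[OF slice_lattice]
    by (simp flip: of_int_vec_simps(3))

  \<comment> \<open>The extra row is free: \<open>- h1\<close> has maximum 0, and
    \<open>h1 + h2 + h3\<close> is \<open>lift 1 c\<close>, whose added 1 does not raise the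
    maximum.\<close>
  have rows: "N (- h1) = 0" "N (- h2) = M a" "N (- h3) = M b" "N (h1 + h2 + h3) = M c"
    using nz support_lift_0 by (simp_all add: h1_def h2_def h3_def lift_simps support_lift c)
  have bound3: "simplex_bound A3 P = L"
    using rows by (simp add: simplex_bound_def A3_def sum_3 L_def)
  have least3: "L \<le> simplex_bound B P" if "det B \<noteq> 0" for B :: "int ^ 3 ^ 3"
  proof -
    define x y z where "x = yz_part (- (B $ 1))" and "y = yz_part (- (B $ 2))" and "z = yz_part (- (B $ 3))"
    have "M (- x - y - z) \<le> N (B $ 1 + B $ 2 + B $ 3)"
      using support_slice_le[of "B $ 1 + B $ 2 + B $ 3"]
      by (rule back_subst[of "\<lambda>w. M w \<le> _"]) (simp add: x_def y_def z_def vec_eq_iff forall_2)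
    then have le: "M x + M y + M z + M (- x - y - z) \<le> simplex_bound B P"
      using support_slice_le[of "- (B $ 1)"] support_slice_le[of "- (B $ 2)"] support_slice_le[of "- (B $ 3)"]
      by (simp add: simplex_bound_def sum_3 x_def y_def z_def)
    \<comment> \<open>These are, up to sign, the cofactors of the first column of \<open>B\<close>,
      so they cannot all vanish.\<close>
    have "det2 x y \<noteq> 0 \<or> det2 x z \<noteq> 0 \<or> det2 y z \<noteq> 0"
    proof (rule ccontr)
      assume "\<not> ?thesis"
      moreover have "det B = B $ 1 $ 1 * det2 y z - B $ 2 $ 1 * det2 x z + B $ 3 $ 1 * det2 x y"
        by (simp add: det_3 det2_def x_def y_def z_def algebra_simps)
      ultimately show False using that by simp
    qed
    text \<open>Merging two of the four functionals \<open>x\<close>, \<open>y\<close>, \<open>z\<close>, \<open>- x - y - z\<close> leaves a triple.\<close>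
    then have "L \<le> M x + M y + M z + M (- x - y - z)"
      using least[of x y "z + (- x - y - z)"] least[of x z "y + (- x - y - z)"]
        least[of y z "x + (- x - y - z)"] subadd[of z "- x - y - z"] subadd[of y "- x - y - z"]
        subadd[of x "- x - y - z"] unfolding L_def by (auto simp: algebra_simps)
    with le show ?thesis by simp
  qed
  have inv3: "invertible A3"
  proof -
    have "h1 = vector [1, 0, 0]" by (simp add: h1_def lift_def)
    moreover have "det2 (- a) (- b) = det2 a b" by (simp add: det2_def)
    ultimately show ?thesis
      using invertible_int_3[of h2 h3] det by (simp add: A3_def h2_def h3_def)
  qed
  have int3: "support P (- of_int_vec (A3 $ i)) \<in> \<int>" for i
    using support_integral[OF lattice, of "- (A3 $ i)"] by simp
  have size3: "lattice_size P = L"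
    using lattice_size_eq[OF P(1,3) inv3 int3] bound3 least3 by simp
  have naive3: "naive_lattice_size (int_mat_image A3 P) = L"
    using naive_lattice_size_image_eq[OF P(1,3) inv3 int3] bound3 least3 by simp
  have basis: "int_basis h1 h2 h3" using inv3 int_basis_if_invertible by (simp add: A3_def)

  have w1: "width (of_int_vec h1) P = 1"
    using support_lift_0 by (simp add: width_eq_support h1_def lift_simps flip: of_int_vec_simps(3))
  have w2: "width (of_int_vec h2) P = wd a" and w3: "width (of_int_vec h3) P = wd b"
    using nz by (simp_all add: h2_def h3_def width_lift)
  \<comment> \<open>Both vectors are lifts of \<open>- a\<close> and \<open>a\<close> with
    \<open>k = 1\<close>, so the second reducedness condition holds with equality.\<close>
  have w12: "width (of_int_vec (h1 + h2)) P = wd a" "width (of_int_vec (h1 - h2)) P = wd a"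
    using nz by (simp_all add: h1_def h2_def lift_simps width_lift del: of_int_vec_simps)
  \<comment> \<open>Projection discards the multiple of \<open>h1\<close>, leaving the planar
    inequality in \<open>n\<close> alone.\<close>
  have w123: "wd b \<le> width (of_int_vec (m *s h1 + n *s h2 + h3)) P" for m n
  proof -
    have "m *s h1 + n *s h2 + h3 = lift m (- (n *s a + b))"
      by (simp add: h1_def h2_def h3_def lift_simps)
    then have "wd (n *s a + b) \<le> width (of_int_vec (m *s h1 + n *s h2 + h3)) P"
      using width_ge[of "m *s h1 + n *s h2 + h3"] by (metis wd_minus yz_part_lift)
    with wd_add_multiple_ge[OF wd(2,3), of n] show ?thesis by (rule order_trans)
  qed
  have "reduced_basis P h1 h2 h3"
    unfolding reduced_basis_def Let_def
    using basis w1 w2 w3 w12 w123 wd(1) wd_ge_2[OF nz(1)] by (simp del: of_int_vec_simps)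
  moreover have "computes_lattice_size P h1 h2 h3"
    using basis size3 naive3 by (simp add: computes_lattice_size_def A3_def)
  ultimately show ?thesis using size2 size3 by auto
qed

end

text \<open>Otherwise every vertex, being a lattice point of the slab, has x = 0, and the primitive
  direction of the x-axis has width 0, against lattice width one.\<close>

lemma top_slice_nonempty:
  assumes P: "lattice_polytope P" and width: "lattice_width P = 1"
    and slab: "P \<subseteq> {p. 0 \<le> p $ 1 \<and> p $ 1 \<le> 1}"
  shows "x_slice 1 P \<noteq> {}"
proof
  assume empty: "x_slice 1 P = {}"
  note PD = lattice_polytopeD[OF P]
  have "p $ 1 = 0" if ext: "p extreme_point_of P" for p
  proof -
    have p: "p \<in> P" "p \<in> int_lattice" using ext PD by (auto simp: extreme_point_of_def)
    then obtain w where w: "p = of_int_vec w" by (auto simp: int_lattice_def)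
    moreover have "0 \<le> w $ 1" "w $ 1 \<le> 1" using slab p w by auto
    moreover have "p $ 1 \<noteq> 1" using p empty by (auto simp: x_slice_eq)
    ultimately show ?thesis by (cases "w $ 1 = 1") auto
  qed
  then have "convex hull {p. p extreme_point_of P} \<subseteq> {p. axis 1 1 \<bullet> p = 0}"
    by (intro hull_minimal convex_hyperplane) (auto simp: inner_axis')
  then have zero: "p $ 1 = 0" if "p \<in> P" for p
    using that Krein_Milman_Minkowski[OF PD(1,2)] by (auto simp: inner_axis')
  define e :: "int ^ 3" where "e = axis 1 1"
  have "of_int_vec e = (axis 1 1 :: real ^ 3)" by (simp add: e_def vec_eq_iff axis_def)
  then have "width (of_int_vec e) P = 0"
    using zero PD(3) by (simp add: width_def inner_axis')
  moreover have "primitive_vec e"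
  proof -
    have "1 \<in> range (\<lambda>i. e $ i)" by (auto simp: e_def axis_def)
    then have "Gcd (range (\<lambda>i. e $ i)) dvd 1" by (rule Gcd_dvd)
    moreover have "e \<noteq> 0" by (simp add: e_def)
    ultimately show ?thesis by (simp add: primitive_vec_def)
  qed
  moreover have "0 \<le> width (of_int_vec h) P" for h
    using PD by (intro width_nonneg)
  ultimately have "lattice_width P \<le> 0"
    unfolding lattice_width_def by (intro cINF_lower2[where x = e] bdd_belowI2[where m = 0]) auto
  with width show False by simp
qed

theorem theorem5p3:
  fixes P :: "(real ^ 3) set"
  assumes "lattice_polytope P"
    and "lattice_width P = 1"
    and "P \<subseteq> {p. 0 \<le> p $ 1 \<and> p $ 1 \<le> 1}"
    and "\<exists>v :: int ^ 2. (\<lambda>q. q + of_int_vec v) ` x_slice 1 P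
           \<subseteq> convex hull (interior (x_slice 0 P) \<inter> int_lattice)"
  shows "lattice_size P = lattice_size (x_slice 0 P) \<and>
    (\<exists>h1 h2 h3. reduced_basis P h1 h2 h3 \<and> computes_lattice_size P h1 h2 h3)"
proof -
  obtain v :: "int ^ 2" where "(\<lambda>q. q + of_int_vec v) ` x_slice 1 P
      \<subseteq> convex hull (interior (x_slice 0 P) \<inter> int_lattice)" using assms(4) by blast
  then interpret width_one_polytope P v
    using assms(1,3) top_slice_nonempty[OF assms(1-3)] by unfold_locales
  show ?thesis by (rule sizes_and_reduced_basis)
qed

end
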